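(* Let $n\ge 1$ and $m\ge 3$, and let $W_{n,m}$ be the join of the edgeless graph $\overline{K_n}$ on $n$ vertices and the cycle $C_m$ (i.e., every vertex of $\overline{K_n}$ is joined to every vertex of $C_m$). Then player B wins the general position avoidance game on $W_{n,m}$ if and only if $m\ge 4$.
   Context: All graphs are finite and simple. A set $S$ of vertices of a graph $G$ is a general position set if no three distinct vertices of $S$ lie on a common shortest path (geodesic) of $G$. In the general position avoidance game on $G$, two players A and B alternately select vertices of $G$, with A moving first; a selection is legal if the vertex was not selected before and the set of all vertices selected so far is a general position set of $G$. The game ends when no legal move remains; the player who selects the last vertex loses. "Player X wins" means X has a winning strategy. *)

theory Defs
  imports "Graph_Theory.Graph_Theory"
begin

text \<open>
  A finite simple graph is a \<open>pair_graph\<close>: every edge is represented by its two opposite arcs.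
\<close>

subsection \<open>General position sets\<close>

definition geodesic :: "'a pair_pre_digraph \<Rightarrow> 'a \<Rightarrow> ('a \<times> 'a) awalk \<Rightarrow> 'a \<Rightarrow> bool" where
  "geodesic G u p v \<longleftrightarrow>
     pre_digraph.apath (with_proj G) u p v \<and>
     (\<forall>q. pre_digraph.apath (with_proj G) u q v \<longrightarrow> length p \<le> length q)"

definition general_position_set :: "'a pair_pre_digraph \<Rightarrow> 'a set \<Rightarrow> bool" where
  "general_position_set G S \<longleftrightarrow>
     S \<subseteq> pverts G \<and>
     \<not> (\<exists>x\<in>S. \<exists>y\<in>S. \<exists>z\<in>S. x \<noteq> y \<and> y \<noteq> z \<and> x \<noteq> z \<and>
          (\<exists>u p v. geodesic G u p v \<and>
             {x, y, z} \<subseteq> set (pre_digraph.awalk_verts (with_proj G) u p)))"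

subsection \<open>The general position avoidance game\<close>

datatype player = Player_A | Player_B

text \<open>A position is the list of the vertices selected so far, in order of selection.\<close>

definition to_move :: "nat \<Rightarrow> player" where
  "to_move k = (if even k then Player_A else Player_B)"

definition legal_moves :: "'a pair_pre_digraph \<Rightarrow> 'a list \<Rightarrow> 'a set" where
  "legal_moves G xs =
     {v \<in> pverts G. v \<notin> set xs \<and> general_position_set G (insert v (set xs))}"

definition legal_play :: "'a pair_pre_digraph \<Rightarrow> 'a list \<Rightarrow> bool" where
  "legal_play G xs \<longleftrightarrow> (\<forall>i < length xs. xs ! i \<in> legal_moves G (take i xs))"

definition follows :: "player \<Rightarrow> ('a list \<Rightarrow> 'a) \<Rightarrow> 'a list \<Rightarrow> bool" where
  "follows X \<sigma> xs \<longleftrightarrow> (\<forall>i < length xs. to_move i = X \<longrightarrow> xs ! i = \<sigma> (take i xs))"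

text \<open>
  A winning strategy must supply a legal move whenever it is consulted while the game is still
  running, and no finished play following it may have its last vertex selected by its owner.
\<close>

definition winning_strategy ::
    "'a pair_pre_digraph \<Rightarrow> player \<Rightarrow> ('a list \<Rightarrow> 'a) \<Rightarrow> bool" where
  "winning_strategy G X \<sigma> \<longleftrightarrow>
     (\<forall>xs. legal_play G xs \<and> follows X \<sigma> xs \<longrightarrow>
        (legal_moves G xs \<noteq> {} \<and> to_move (length xs) = X \<longrightarrow> \<sigma> xs \<in> legal_moves G xs) \<and>
        (legal_moves G xs = {} \<longrightarrow> xs \<noteq> [] \<and> to_move (length xs - 1) \<noteq> X))"

definition wins_gp_avoidance :: "player \<Rightarrow> 'a pair_pre_digraph \<Rightarrow> bool" where
  "wins_gp_avoidance X G \<longleftrightarrow> (\<exists>\<sigma>. winning_strategy G X \<sigma>)"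

subsection \<open>Generalised wheels\<close>

definition edgeless_graph :: "nat \<Rightarrow> nat pair_pre_digraph" where
  "edgeless_graph n = \<lparr> pverts = {..<n}, parcs = {} \<rparr>"

text \<open>For \<open>m < 3\<close> this is not the usual cycle (\<open>m = 1\<close> gives a loop).\<close>

definition cycle_graph :: "nat \<Rightarrow> nat pair_pre_digraph" where
  "cycle_graph m = \<lparr> pverts = {..<m},
     parcs = {(i, j). i < m \<and> j < m \<and> (j = (i + 1) mod m \<or> i = (j + 1) mod m)} \<rparr>"

definition graph_join ::
    "'a pair_pre_digraph \<Rightarrow> 'b pair_pre_digraph \<Rightarrow> ('a + 'b) pair_pre_digraph" where
  "graph_join G H = \<lparr> pverts = pverts G <+> pverts H,
     parcs = {(Inl u, Inl v) | u v. (u, v) \<in> parcs G}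
           \<union> {(Inr u, Inr v) | u v. (u, v) \<in> parcs H}
           \<union> {(Inl u, Inr v) | u v. u \<in> pverts G \<and> v \<in> pverts H}
           \<union> {(Inr v, Inl u) | u v. u \<in> pverts G \<and> v \<in> pverts H} \<rparr>"

definition wheel_join :: "nat \<Rightarrow> nat \<Rightarrow> (nat + nat) pair_pre_digraph" where
  "wheel_join n m = graph_join (edgeless_graph n) (cycle_graph m)"

lemma pair_graph_wheel_join:
  assumes "m \<ge> 3"
  shows "pair_graph (wheel_join n m)"
proof -
  let ?W = "wheel_join n m"
  have ne: "i \<noteq> Suc i mod m" if "i < m" for i
    using that assms by (cases "Suc i = m") auto
  have sub: "parcs ?W \<subseteq> pverts ?W \<times> pverts ?W"
    by (auto simp: wheel_join_def graph_join_def edgeless_graph_def cycle_graph_def)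
  have fin: "finite (pverts ?W)"
    by (auto simp: wheel_join_def graph_join_def edgeless_graph_def cycle_graph_def)
  have sym: "sym (parcs ?W)"
    by (auto simp: sym_def wheel_join_def graph_join_def edgeless_graph_def cycle_graph_def)
  have loops: "fst e \<noteq> snd e" if "e \<in> parcs ?W" for e
    using that
    by (auto simp: wheel_join_def graph_join_def edgeless_graph_def cycle_graph_def dest: ne)
  show ?thesis
  proof
    show "finite (parcs ?W)" using sub fin by (meson finite_SigmaI finite_subset)
  qed (use sub fin sym loops in \<open>auto simp: symmetric_def\<close>)
qed

end

theory Submission
  imports Defs
begin

text \<open>
  The wheel has diameter two, so a vertex set is in general position iff it contains no induced
  path on three vertices. A general position set with a vertex on either side of the join is
  therefore a clique. If \<open>m \<ge> 4\<close>, the maximal cliques are triangles: B answers the first move on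
  the opposite side of the join, and A is forced to select the third and last vertex. If \<open>m = 3\<close>,
  A opens on the cycle; from then on the selected set always lies in some \<open>K\<^sub>4\<close> consisting of the
  cycle and one further vertex, and B selects the fourth and last vertex.
\<close>

section \<open>General position in graphs of diameter at most two\<close>

lemma general_position_set_mono:
  assumes "general_position_set G T" "S \<subseteq> T"
  shows "general_position_set G S"
proof -
  have mono: "\<exists>x\<in>T. \<exists>y\<in>T. \<exists>z\<in>T. P x y z" if "\<exists>x\<in>S. \<exists>y\<in>S. \<exists>z\<in>S. P x y z" for P
    using that assms(2) by blast
  show ?thesis
    using assms unfolding general_position_set_def
    by (elim conjE, intro conjI) (erule (1) order_trans, erule contrapos_nn, erule mono)
qed

text \<open>A geodesic through three vertices has at least two arcs, and by \<open>diam\<close> at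
  most two. So the three vertices are all of its vertices, and they form a path whose ends are not
  adjacent.\<close>

lemma general_position_set_diameter_two:
  assumes "pair_graph G"
    and diam: "\<And>u v. u \<in> pverts G \<Longrightarrow> v \<in> pverts G \<Longrightarrow> u \<noteq> v \<Longrightarrow> (u, v) \<notin> parcs G \<Longrightarrow>
      \<exists>w. (u, w) \<in> parcs G \<and> (w, v) \<in> parcs G"
  shows "general_position_set G S \<longleftrightarrow> S \<subseteq> pverts G \<and>
    (\<forall>x\<in>S. \<forall>y\<in>S. \<forall>z\<in>S. (x, y) \<in> parcs G \<longrightarrow> (y, z) \<in> parcs G \<longrightarrow> x = z \<or> (x, z) \<in> parcs G)"
    (is "_ \<longleftrightarrow> _ \<and> ?no_P3")
proof -
  interpret pair_graph G by fact
  have irrefl: "a \<noteq> b" if "(a, b) \<in> parcs G" for a b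
    using no_loops that by fastforce
  have edge_path: "apath u [(u, v)] v" if "(u, v) \<in> parcs G" for u v
    using that in_arcsD1 in_arcsD2 irrefl[OF that]
    by (auto simp: apath_def awalk_Cons_iff awalk_Nil_iff)
  have two_path: "apath u [(u, w), (w, v)] v"
    if "(u, w) \<in> parcs G" "(w, v) \<in> parcs G" "u \<noteq> v" for u w v
    using that in_arcsD1 in_arcsD2 irrefl[OF that(1)] irrefl[OF that(2)]
    by (auto simp: apath_def awalk_Cons_iff awalk_Nil_iff)
  have geodesic_two: "geodesic G x [(x, y), (y, z)] z"
    if "(x, y) \<in> parcs G" "(y, z) \<in> parcs G" "x \<noteq> z" "(x, z) \<notin> parcs G" for x y z
    unfolding geodesic_def
  proof (intro conjI allI impI)
    show "apath x [(x, y), (y, z)] z"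
      using two_path that by blast
    fix q assume q: "apath x q z"
    show "length [(x, y), (y, z)] \<le> length q"
    \<comment> \<open>A shorter walk has at most one arc: none would force \<open>x = z\<close>, and
      one would be the missing arc from \<open>x\<close> to \<open>z\<close>.\<close>
    proof (rule ccontr)
      assume "\<not> ?thesis"
      then consider "q = []" | e where "q = [e]"
        by (cases q; cases "tl q") auto
      then show False
        using q that by cases (auto simp: apath_def awalk_Cons_iff awalk_Nil_iff)
    qed
  qed
  show ?thesis
  proof (intro iffI conjI)
    assume gp: "general_position_set G S"
    then show "S \<subseteq> pverts G"
      by (simp add: general_position_set_def)
    show ?no_P3
    proof (intro ballI impI, rule ccontr)
      fix x y z
      assume S: "x \<in> S" "y \<in> S" "z \<in> S"
        and e: "(x, y) \<in> parcs G" "(y, z) \<in> parcs G"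
        and not_e: "\<not> (x = z \<or> (x, z) \<in> parcs G)"
      then have "geodesic G x [(x, y), (y, z)] z"
        using geodesic_two by blast
      moreover have "{x, y, z} \<subseteq> set (awalk_verts x [(x, y), (y, z)])"
        by simp
      ultimately have "\<exists>u p v. geodesic G u p v \<and> {x, y, z} \<subseteq> set (awalk_verts u p)"
        by (intro exI conjI)
      moreover have "x \<noteq> y" "y \<noteq> z" "x \<noteq> z"
        using irrefl[OF e(1)] irrefl[OF e(2)] not_e by auto
      ultimately have "\<exists>x\<in>S. \<exists>y\<in>S. \<exists>z\<in>S. x \<noteq> y \<and> y \<noteq> z \<and> x \<noteq> z \<and>
          (\<exists>u p v. geodesic G u p v \<and> {x, y, z} \<subseteq> set (awalk_verts u p))"
        using S by (intro bexI[of _ x] bexI[of _ y] bexI[of _ z] conjI)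
      then show False
        using gp by (simp only: general_position_set_def awalk_verts_with_proj_eq simp_thms)
    qed
  next
    assume R: "S \<subseteq> pverts G \<and> ?no_P3"
    show "general_position_set G S"
      unfolding general_position_set_def awalk_verts_with_proj_eq
    proof (intro conjI notI)
      show "S \<subseteq> pverts G"
        using R by blast
      assume "\<exists>x\<in>S. \<exists>y\<in>S. \<exists>z\<in>S. x \<noteq> y \<and> y \<noteq> z \<and> x \<noteq> z \<and>
          (\<exists>u p v. geodesic G u p v \<and> {x, y, z} \<subseteq> set (awalk_verts u p))"
      then obtain x y z u p v where S: "x \<in> S" "y \<in> S" "z \<in> S"
        and d: "x \<noteq> y" "y \<noteq> z" "x \<noteq> z" and geo: "geodesic G u p v"
        and sub: "{x, y, z} \<subseteq> set (awalk_verts u p)"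
        by (elim bexE exE conjE) (rule that)
      have path: "apath u p v" and least: "\<And>q. apath u q v \<Longrightarrow> length p \<le> length q"
        using geo by (auto simp: geodesic_def)
      \<comment> \<open>A walk has one vertex more than arcs, so three distinct vertices require two
        arcs.\<close>
      have "card {x, y, z} \<le> length (awalk_verts u p)"
        using sub by (meson List.finite_set card_length card_mono le_trans)
      then have len: "2 \<le> length p"
        using d by (simp add: length_awalk_verts)
      have uv: "u \<in> pverts G" "v \<in> pverts G"
        using path by (auto simp: apath_def dest: awalk_hd_in_verts awalk_last_in_verts)
      have "u \<noteq> v"
        using path len by (metis apath_nonempty_ends list.size(3) not_numeral_le_zero)
      have no_edge: "(u, v) \<notin> parcs G"
        using least[OF edge_path] len by fastforce
      then obtain w where "(u, w) \<in> parcs G" "(w, v) \<in> parcs G"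
        using diam uv \<open>u \<noteq> v\<close> by blast
      then have "length p = 2"
        using least[OF two_path] \<open>u \<noteq> v\<close> len by fastforce
      then obtain e f where p: "p = [e, f]"
        by (auto simp: numeral_2_eq_2 length_Suc_conv)
      with path obtain w where w: "p = [(u, w), (w, v)]" "(u, w) \<in> parcs G" "(w, v) \<in> parcs G"
        by (cases e; cases f) (auto simp: apath_def awalk_Cons_iff awalk_Nil_iff)
      \<comment> \<open>Three distinct vertices among the three of the geodesic exhaust it, in
        whatever order, so its ends and middle all lie in \<open>S\<close>.\<close>
      with sub d have "{u, w, v} = {x, y, z}"
        by auto
      with S have "{u, w, v} \<subseteq> S"
        by simp
      with R w \<open>u \<noteq> v\<close> no_edge show False
        by blast
    qed
  qed
qed

section \<open>Plays extended by one move\<close>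

lemma legal_play_snoc:
  "legal_play G (xs @ [x]) \<longleftrightarrow> legal_play G xs \<and> x \<in> legal_moves G xs"
  by (auto simp: legal_play_def nth_append less_Suc_eq)

lemma legal_play_Nil [simp]: "legal_play G []"
  by (simp add: legal_play_def)

lemma legal_play_take: "legal_play G xs \<Longrightarrow> legal_play G (take k xs)"
  by (auto simp: legal_play_def)

lemma legal_play_distinct: "legal_play G xs \<Longrightarrow> distinct xs"
  by (induction xs rule: rev_induct) (auto simp: legal_play_snoc legal_moves_def)

lemma legal_play_general_position:
  "legal_play G xs \<Longrightarrow> xs \<noteq> [] \<Longrightarrow> general_position_set G (set xs)"
  by (cases xs rule: rev_cases) (auto simp: legal_play_snoc legal_moves_def)

lemma follows_snoc:
  "follows X \<sigma> (xs @ [x]) \<longleftrightarrow> follows X \<sigma> xs \<and> (to_move (length xs) = X \<longrightarrow> x = \<sigma> xs)"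
  by (auto simp: follows_def nth_append less_Suc_eq)

lemma follows_Nil [simp]: "follows X \<sigma> []"
  by (simp add: follows_def)

section \<open>Adjacency and general position in the wheel\<close>

lemma pverts_wheel_join [simp]:
  "Inl i \<in> pverts (wheel_join n m) \<longleftrightarrow> i < n"
  "Inr j \<in> pverts (wheel_join n m) \<longleftrightarrow> j < m"
  by (auto simp: wheel_join_def graph_join_def edgeless_graph_def cycle_graph_def)

lemma parcs_wheel_join [simp]:
  "(Inl i, Inl i') \<notin> parcs (wheel_join n m)"
  "(Inl i, Inr j) \<in> parcs (wheel_join n m) \<longleftrightarrow> i < n \<and> j < m"
  "(Inr j, Inl i) \<in> parcs (wheel_join n m) \<longleftrightarrow> i < n \<and> j < m"
  "(Inr j, Inr j') \<in> parcs (wheel_join n m) \<longleftrightarrow>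
     j < m \<and> j' < m \<and> (j' = Suc j mod m \<or> j = Suc j' mod m)"
  by (auto simp: wheel_join_def graph_join_def edgeless_graph_def cycle_graph_def)

text \<open>Going once around a triangle would add three steps of +1 or -1, with sum an odd number
  between -3 and 3, which is not divisible by \<open>m\<close> when
  \<open>m \<ge> 4\<close>.\<close>

lemma cycle_triangle_free:
  assumes "m \<ge> 4" "a < m" "b < m" "c < m"
    and "b = Suc a mod m \<or> a = Suc b mod m"
    and "c = Suc b mod m \<or> b = Suc c mod m"
    and "c = Suc a mod m \<or> a = Suc c mod m"
  shows False
proof -
  \<comment> \<open>Separating the wrap-around case removes \<open>mod\<close>; linear arithmetic
    then decides each combination.\<close>
  have succ: "l = Suc k mod m \<longleftrightarrow> l = Suc k \<and> l < m \<or> l = 0 \<and> Suc k = m" if "k < m" for k l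
    using that by (cases "Suc k = m") auto
  show False
    using assms unfolding succ[OF \<open>a < m\<close>] succ[OF \<open>b < m\<close>] succ[OF \<open>c < m\<close>]
    by (elim disjE conjE; linarith)
qed

context
  fixes n m :: nat
  assumes n: "n \<ge> 1" and m: "m \<ge> 3"
begin

abbreviation (input) "W \<equiv> wheel_join n m"

lemma wheel_general_position_iff:
  "general_position_set W S \<longleftrightarrow> S \<subseteq> pverts W \<and>
    (\<forall>x\<in>S. \<forall>y\<in>S. \<forall>z\<in>S. (x, y) \<in> parcs W \<longrightarrow> (y, z) \<in> parcs W \<longrightarrow> x = z \<or> (x, z) \<in> parcs W)"
proof (rule general_position_set_diameter_two[OF pair_graph_wheel_join[OF m]])
  fix u v assume "u \<in> pverts W" "v \<in> pverts W" "(u, v) \<notin> parcs W"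
  \<comment> \<open>Nonadjacent vertices lie on the same side of the join, so any vertex of the
    other side is a common neighbour; vertex \<open>0\<close> of each side exists.\<close>
  then show "\<exists>w. (u, w) \<in> parcs W \<and> (w, v) \<in> parcs W"
    using n m
    by (cases u; cases v) (auto intro: exI[of _ "Inl 0"] exI[of _ "Inr 0"])
qed

lemma clique_general_position:
  assumes "S \<subseteq> pverts W" "\<And>x y. x \<in> S \<Longrightarrow> y \<in> S \<Longrightarrow> x \<noteq> y \<Longrightarrow> (x, y) \<in> parcs W"
  shows "general_position_set W S"
  unfolding wheel_general_position_iff
  by (intro conjI ballI impI, fact) (use assms(2) in metis)

text \<open>Vertices on opposite sides are always adjacent. Two on the same side have
  \<open>Inl i\<close> or \<open>Inr j\<close> as a common neighbour in \<open>S\<close>, so general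
  position forces them to be adjacent. In particular \<open>Inl i\<close> is the only vertex of
  \<open>S\<close> on its side.\<close>

lemma mixed_general_position_clique:
  assumes gp: "general_position_set W S" and mixed: "Inl i \<in> S" "Inr j \<in> S"
    and "x \<in> S" "y \<in> S" "x \<noteq> y"
  shows "(x, y) \<in> parcs W"
proof -
  have V: "S \<subseteq> pverts W"
    and P3: "\<And>w. w \<in> S \<Longrightarrow> (x, w) \<in> parcs W \<Longrightarrow> (w, y) \<in> parcs W \<Longrightarrow> (x, y) \<in> parcs W"
    using gp assms(4-6) unfolding wheel_general_position_iff by auto
  have "i < n" "j < m" "x \<in> pverts W" "y \<in> pverts W"
    using V assms by auto
  then show ?thesis
    using P3[OF mixed(1)] P3[OF mixed(2)] by (cases x; cases y) auto
qed

text \<open>Since \<open>S\<close> is a clique, \<open>x\<close> and \<open>y\<close> must lie on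
  the cycle, where they would form a triangle with \<open>Inr j\<close>.\<close>

lemma mixed_general_position_at_most_three:
  assumes "m \<ge> 4" and gp: "general_position_set W S" and mixed: "Inl i \<in> S" "Inr j \<in> S"
    and S: "x \<in> S" "y \<in> S" and "x \<noteq> y" "x \<notin> {Inl i, Inr j}" "y \<notin> {Inl i, Inr j}"
  shows False
proof -
  note adj = mixed_general_position_clique[OF gp mixed]
  obtain a where a: "x = Inr a"
    using adj[OF mixed(1) S(1)] assms by (cases x) auto
  obtain b where b: "y = Inr b"
    using adj[OF mixed(1) S(2)] assms by (cases y) auto
  show False
    using adj[OF mixed(2) S(1)] adj[OF mixed(2) S(2)] adj[OF S] assms(7-)
      cycle_triangle_free[OF \<open>m \<ge> 4\<close>, of j a b]
    unfolding a b by auto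
qed

section \<open>The strategy of B for \<open>m \<ge> 4\<close>\<close>

text \<open>Only the first vertex is inspected, since B moves just once before the game
  ends.\<close>

definition reply :: "(nat + nat) list \<Rightarrow> nat + nat" where
  "reply xs = (case hd xs of Inl _ \<Rightarrow> Inr 0 | Inr _ \<Rightarrow> Inl 0)"

lemma reply_legal:
  assumes "legal_play W [x]"
  shows "reply [x] \<in> legal_moves W [x]"
proof -
  have "x \<in> pverts W"
    using assms legal_play_snoc[of W "[]" x] by (simp add: legal_moves_def)
  then show ?thesis
    using n m unfolding legal_moves_def reply_def
    by (cases x) (auto intro!: clique_general_position)
qed

text \<open>This keeps B's reply from being the last move: an edge across the join extends to a
  triangle by the successor of its rim vertex on the cycle.\<close>

lemma triangle_move_exists:
  assumes "legal_play W [x]"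
  shows "legal_moves W [x, reply [x]] \<noteq> {}"
proof -
  have edge: "Suc j mod m < m" "Suc j mod m \<noteq> j" if "j < m" for j
    using that m by (cases "Suc j = m"; simp)+
  have tri: "general_position_set W {Inl i, Inr j, Inr (Suc j mod m)}" if "i < n" "j < m" for i j
    using that edge by (intro clique_general_position) auto
  have "x \<in> pverts W"
    using assms legal_play_snoc[of W "[]" x] by (simp add: legal_moves_def)
  then obtain i j where "set [x, reply [x]] = {Inl i, Inr j}" "i < n" "j < m"
    using n m unfolding reply_def by (cases x) (auto simp: insert_commute)
  then have "Inr (Suc j mod m) \<in> legal_moves W [x, reply [x]]"
    using tri[of i j] edge[of j] by (auto simp: legal_moves_def insert_commute)
  then show ?thesis by blast
qed

text \<open>The first two vertices lie on opposite sides of the join, so a fourth vertex would break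
  the bound of three on mixed general position sets.\<close>

lemma triangle_maximal:
  assumes "m \<ge> 4" and play: "legal_play W [x, reply [x], z]"
  shows "legal_moves W [x, reply [x], z] = {}"
proof (rule ccontr)
  assume "\<not> ?thesis"
  then obtain w where w: "legal_play W ([x, reply [x], z] @ [w])"
    using play unfolding legal_play_snoc by blast
  obtain i j where ij: "{x, reply [x]} = {Inl i, Inr j}"
    unfolding reply_def by (cases x) auto
  have "distinct [x, reply [x], z, w]" "general_position_set W {x, reply [x], z, w}"
    using legal_play_distinct[OF w] legal_play_general_position[OF w] by auto
  moreover from this ij have "z \<notin> {Inl i, Inr j}" "w \<notin> {Inl i, Inr j}"
    unfolding ij[symmetric] by auto
  ultimately show False
    using mixed_general_position_at_most_three[OF \<open>m \<ge> 4\<close>, of "{x, reply [x], z, w}" i j z w] ij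
    by auto
qed

lemma reply_winning:
  assumes "m \<ge> 4"
  shows "winning_strategy W Player_B reply"
  unfolding winning_strategy_def
proof (intro allI impI, elim conjE)
  fix xs assume play: "legal_play W xs" and foll: "follows Player_B reply xs"
  let ?goal = "(legal_moves W xs \<noteq> {} \<and> to_move (length xs) = Player_B \<longrightarrow>
      reply xs \<in> legal_moves W xs) \<and>
    (legal_moves W xs = {} \<longrightarrow> xs \<noteq> [] \<and> to_move (length xs - 1) \<noteq> Player_B)"
  have len: "length xs \<le> 3"
  proof (rule ccontr)
    assume "\<not> ?thesis"
    then obtain x y z w ys where xs: "xs = x # y # z # w # ys"
      by (cases xs; cases "tl xs"; cases "tl (tl xs)"; cases "tl (tl (tl xs))") auto
    then have "y = reply [x]"
      using foll by (auto simp: follows_def to_move_def dest: spec[of _ 1])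
    moreover have "legal_play W ([x, y, z] @ [w])"
      using legal_play_take[OF play, of 4] xs by simp
    ultimately show False
      using triangle_maximal[OF assms] unfolding legal_play_snoc by blast
  qed
  consider "xs = []" | x where "xs = [x]" | x y where "xs = [x] @ [y]"
    | x y z where "xs = ([x] @ [y]) @ [z]"
    using len by (cases xs; cases "tl xs"; cases "tl (tl xs)") auto
  then show ?goal
  proof cases
    case 1
    \<comment> \<open>The empty play must not be terminal, because a terminal play is required to be
      nonempty.\<close>
    have "Inl 0 \<in> legal_moves W []"
      using n by (auto simp: legal_moves_def intro!: clique_general_position)
    then show ?thesis
      using 1 by (auto simp: to_move_def)
  next
    case 2
    then show ?thesis
      using reply_legal play by blast
  next
    case 3
    then have "y = reply [x]" "legal_play W [x]"
      using foll play unfolding 3 follows_snoc legal_play_snoc by (auto simp: to_move_def)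
    then show ?thesis
      using triangle_move_exists 3 by (auto simp: to_move_def)
  next
    case 4
    then have "y = reply [x]"
      using foll unfolding 4 follows_snoc by (simp add: to_move_def)
    \<comment> \<open>The last vertex has the even index 2, so A selected it.\<close>
    then show ?thesis
      using triangle_maximal[OF assms] play 4 by (simp add: to_move_def)
  qed
qed

section \<open>The strategy of A for \<open>m = 3\<close>\<close>

abbreviation K4 :: "nat \<Rightarrow> (nat + nat) set" where
  "K4 i \<equiv> insert (Inl i) (Inr ` {..<3})"

lemma card_K4: "card (K4 i) = 4"
proof -
  have "card (Inr ` {..<3} :: (nat + nat) set) = 3"
    by (simp add: card_image)
  then show ?thesis
    by (subst card_insert_disjoint) auto
qed

lemma K4_general_position:
  assumes "m = 3" "i < n"
  shows "general_position_set W (K4 i)"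
proof (rule clique_general_position)
  have triangle: "b = Suc a mod 3 \<or> a = Suc b mod 3" if "a < 3" "b < 3" "a \<noteq> b" for a b :: nat
  proof -
    have "a = 0 \<or> a = 1 \<or> a = 2" "b = 0 \<or> b = 1 \<or> b = 2"
      using that by linarith+
    then show ?thesis
      using \<open>a \<noteq> b\<close> by (elim disjE) simp_all
  qed
  show "(x, y) \<in> parcs W" if "x \<in> K4 i" "y \<in> K4 i" "x \<noteq> y" for x y
    \<comment> \<open>The values of \<open>projr\<close> matter only when both vertices are on the
      rim.\<close>
    using that triangle[of "projr x" "projr y"] assms by (cases x; cases y) auto
qed (use assms in auto)

text \<open>A mixed set is a clique and so has a single vertex off the rim, which determines
  \<open>i\<close>. A set inside the rim fits into every \<open>K4 i\<close>, and
  \<open>i = 0\<close> is available because \<open>n \<ge> 1\<close>.\<close>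

lemma general_position_subset_K4:
  assumes "m = 3" and gp: "general_position_set W S" and rim: "Inr j \<in> S"
  obtains i where "i < n" "S \<subseteq> K4 i"
proof (cases "\<exists>i. Inl i \<in> S")
  case True
  then obtain i where i: "Inl i \<in> S" by blast
  have V: "S \<subseteq> pverts W"
    using gp by (simp add: general_position_set_def)
  have "x \<in> K4 i" if "x \<in> S" for x
    using mixed_general_position_clique[OF gp i rim i that] subsetD[OF V that] assms(1)
    by (cases x) auto
  moreover have "i < n"
    using subsetD[OF V i] by simp
  ultimately show thesis
    using that[of i] by blast
next
  case False
  have V: "S \<subseteq> pverts W"
    using gp by (simp add: general_position_set_def)
  have "x \<in> K4 0" if "x \<in> S" for x
    using False subsetD[OF V that] that assms(1) by (cases x) auto
  moreover have "0 < n"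
    using n by simp
  ultimately show thesis
    using that[of 0] by blast
qed

text \<open>Once a rim vertex is selected, the length of the game is forced: the selected set stays
  inside some \<open>K4 i\<close>, and as long as it is a proper subset, any missing vertex of that
  \<open>K4 i\<close> is legal.\<close>

lemma rim_play_legal_moves:
  assumes "m = 3" and play: "legal_play W xs" and rim: "Inr j \<in> set xs"
  shows "legal_moves W xs \<noteq> {} \<longleftrightarrow> length xs < 4"
proof
  assume "legal_moves W xs \<noteq> {}"
  then obtain v where v: "legal_play W (xs @ [v])"
    using play unfolding legal_play_snoc by blast
  have "Inr j \<in> set (xs @ [v])"
    using rim by simp
  then obtain i where "set (xs @ [v]) \<subseteq> K4 i"
    using general_position_subset_K4[OF \<open>m = 3\<close> legal_play_general_position[OF v]] by blast
  then have "card (set (xs @ [v])) \<le> 4"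
    using card_mono[of "K4 i"] card_K4 by fastforce
  then show "length xs < 4"
    using distinct_card[OF legal_play_distinct[OF v]] by simp
next
  assume "length xs < 4"
  moreover have "general_position_set W (set xs)"
    using legal_play_general_position[OF play] rim by fastforce
  then obtain i where i: "i < n" "set xs \<subseteq> K4 i"
    using general_position_subset_K4[OF \<open>m = 3\<close> _ rim] by blast
  ultimately have "set xs \<noteq> K4 i"
    using card_length[of xs] card_K4[of i] by (metis leD)
  with i obtain v where "v \<in> K4 i" "v \<notin> set xs"
    by (meson subsetI subset_antisym)
  moreover from this i have "general_position_set W (insert v (set xs))"
    using general_position_set_mono[OF K4_general_position[OF \<open>m = 3\<close>]]
    by (meson insert_subsetI)
  ultimately have "v \<in> legal_moves W xs"
    unfolding legal_moves_def general_position_set_def by blast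
  then show "legal_moves W xs \<noteq> {}"
    by blast
qed

text \<open>A opens with \<open>Inr 0\<close>; after that A may play any legal move, since every
  play then has exactly four moves and B makes the fourth. The play against \<open>\<sigma>\<close>
  is built move by move.\<close>

lemma B_loses_three:
  assumes "m = 3"
  shows "\<not> winning_strategy W Player_B \<sigma>"
proof
  assume win: "winning_strategy W Player_B \<sigma>"
  note moves = rim_play_legal_moves[OF assms, of _ 0]
  have B_move: "\<sigma> xs \<in> legal_moves W xs"
    if "legal_play W xs" "follows Player_B \<sigma> xs" "odd (length xs)" "legal_moves W xs \<noteq> {}" for xs
    using win that unfolding winning_strategy_def to_move_def by auto
  let ?p1 = "[] @ [Inr 0]"
  have p1: "legal_play W ?p1" "follows Player_B \<sigma> ?p1"
    unfolding legal_play_snoc follows_snoc using m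
    by (auto simp: legal_moves_def to_move_def intro!: clique_general_position)
  let ?p2 = "?p1 @ [\<sigma> ?p1]"
  have "\<sigma> ?p1 \<in> legal_moves W ?p1"
    using p1 moves[of ?p1] by (intro B_move) auto
  then have p2: "legal_play W ?p2" "follows Player_B \<sigma> ?p2"
    using p1 unfolding legal_play_snoc[of _ ?p1] follows_snoc[of _ _ ?p1] by auto
  then obtain v where v: "v \<in> legal_moves W ?p2"
    using moves[of ?p2] by auto
  let ?p3 = "?p2 @ [v]"
  have p3: "legal_play W ?p3" "follows Player_B \<sigma> ?p3"
    using p2 v unfolding legal_play_snoc[of _ ?p2] follows_snoc[of _ _ ?p2]
    by (auto simp: to_move_def)
  let ?p4 = "?p3 @ [\<sigma> ?p3]"
  have "\<sigma> ?p3 \<in> legal_moves W ?p3"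
    using p3 moves[of ?p3] by (intro B_move) auto
  then have p4: "legal_play W ?p4" "follows Player_B \<sigma> ?p4"
    using p3 unfolding legal_play_snoc[of _ ?p3] follows_snoc[of _ _ ?p3] by auto
  then have "legal_moves W ?p4 = {}"
    using moves[of ?p4] by auto
  \<comment> \<open>The fourth vertex has index 3, which is odd and hence belongs to B.\<close>
  then have "to_move (length ?p4 - 1) \<noteq> Player_B"
    using win p4 unfolding winning_strategy_def by blast
  then show False
    by (simp add: to_move_def)
qed

end

theorem theorem2p6:
  fixes n m :: nat
  assumes "n \<ge> 1" and "m \<ge> 3"
  shows "wins_gp_avoidance Player_B (wheel_join n m) \<longleftrightarrow> m \<ge> 4"
proof
  assume "wins_gp_avoidance Player_B (wheel_join n m)"
  then have "m \<noteq> 3"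
    using B_loses_three[OF assms] by (auto simp: wins_gp_avoidance_def)
  then show "m \<ge> 4"
    using assms by simp
next
  assume "m \<ge> 4"
  then show "wins_gp_avoidance Player_B (wheel_join n m)"
    using reply_winning[OF assms] by (auto simp: wins_gp_avoidance_def)
qed

end
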